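(* Let $X$ be a connected topological space, let $\mathbf{H}$ be a $1$-independent Hilbert space of continuous functions over $X$, and let $\omega\in Mult(\mathbf{H})$ be non-constant with $\|\omega\|_{Mult(\mathbf{H})}=\sup_{x\in X}|\omega(x)|$. Then $Mult(\mathbf{H})$ is not separable.
   Context: A Hilbert space of continuous functions over $X$ is a linear subspace of the space $C(X)$ of continuous complex functions on $X$, equipped with a Hilbert space norm whose topology is stronger than the compact-open topology. It is $1$-independent if for each $x\in X$ some $f\in\mathbf{H}$ has $f(x)\ne0$. $Mult(\mathbf{H})$ is the set of $\omega:X\to\mathbb{C}$ with $\omega f\in\mathbf{H}$ for all $f\in\mathbf{H}$ and $M_\omega:f\mapsto\omega f$ bounded on $\mathbf{H}$, normed by $\|\omega\|_{Mult(\mathbf{H})}=\|M_\omega\|$. *)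

theory Defs
  imports "HOL-Analysis.Analysis"
begin

text \<open>A Hilbert space of continuous functions over X: a set H of continuous complex
functions on X (extended by 0 outside topspace X), a linear subspace, together with an
inner product ip making it a (complex) Hilbert space, whose norm topology is finer than the
compact-open topology (every subbasic compact-open set is norm-open in H).\<close>

definition hnorm :: "(('a \<Rightarrow> complex) \<Rightarrow> ('a \<Rightarrow> complex) \<Rightarrow> complex) \<Rightarrow> ('a \<Rightarrow> complex) \<Rightarrow> real" where
  "hnorm ip f = sqrt (Re (ip f f))"

definition hilbert_fun_space ::
  "'a topology \<Rightarrow> ('a \<Rightarrow> complex) set \<Rightarrow> (('a \<Rightarrow> complex) \<Rightarrow> ('a \<Rightarrow> complex) \<Rightarrow> complex) \<Rightarrow> bool" where
  "hilbert_fun_space X H ip \<longleftrightarrow>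
     \<comment> \<open>linear subspace of C(X)\<close>
     (\<forall>f\<in>H. continuous_map X euclidean f \<and> (\<forall>x. x \<notin> topspace X \<longrightarrow> f x = 0)) \<and>
     (\<lambda>x. 0) \<in> H \<and>
     (\<forall>f\<in>H. \<forall>g\<in>H. (\<lambda>x. f x + g x) \<in> H) \<and>
     (\<forall>c. \<forall>f\<in>H. (\<lambda>x. c * f x) \<in> H) \<and>
     \<comment> \<open>inner product axioms\<close>
     (\<forall>f\<in>H. \<forall>g\<in>H. \<forall>h\<in>H. ip (\<lambda>x. f x + g x) h = ip f h + ip g h) \<and>
     (\<forall>c. \<forall>f\<in>H. \<forall>g\<in>H. ip (\<lambda>x. c * f x) g = c * ip f g) \<and>
     (\<forall>f\<in>H. \<forall>g\<in>H. ip g f = cnj (ip f g)) \<and>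
     (\<forall>f\<in>H. 0 \<le> Re (ip f f)) \<and>
     (\<forall>f\<in>H. ip f f = 0 \<longrightarrow> f = (\<lambda>x. 0)) \<and>
     \<comment> \<open>completeness\<close>
     (\<forall>s. (\<forall>n. s n \<in> H) \<longrightarrow>
          (\<forall>e>0. \<exists>N. \<forall>m\<ge>N. \<forall>n\<ge>N. hnorm ip (\<lambda>x. s m x - s n x) < e) \<longrightarrow>
          (\<exists>g\<in>H. (\<lambda>n. hnorm ip (\<lambda>x. s n x - g x)) \<longlonglongrightarrow> 0)) \<and>
     \<comment> \<open>norm topology stronger than the compact-open topology\<close>
     (\<forall>K U. compactin X K \<longrightarrow> open (U :: complex set) \<longrightarrow>
        (\<forall>f\<in>H. f ` K \<subseteq> U \<longrightarrow>
           (\<exists>e>0. \<forall>g\<in>H. hnorm ip (\<lambda>x. g x - f x) < e \<longrightarrow> g ` K \<subseteq> U)))"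

definition one_independent :: "'a topology \<Rightarrow> ('a \<Rightarrow> complex) set \<Rightarrow> bool" where
  "one_independent X H \<longleftrightarrow> (\<forall>x\<in>topspace X. \<exists>f\<in>H. f x \<noteq> 0)"

definition Mult ::
  "'a topology \<Rightarrow> ('a \<Rightarrow> complex) set \<Rightarrow> (('a \<Rightarrow> complex) \<Rightarrow> ('a \<Rightarrow> complex) \<Rightarrow> complex)
   \<Rightarrow> ('a \<Rightarrow> complex) set" where
  "Mult X H ip = {w. (\<forall>x. x \<notin> topspace X \<longrightarrow> w x = 0) \<and>
                     (\<forall>f\<in>H. (\<lambda>x. w x * f x) \<in> H) \<and>
                     (\<exists>C. \<forall>f\<in>H. hnorm ip (\<lambda>x. w x * f x) \<le> C * hnorm ip f)}"

definition mult_norm ::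
  "('a \<Rightarrow> complex) set \<Rightarrow> (('a \<Rightarrow> complex) \<Rightarrow> ('a \<Rightarrow> complex) \<Rightarrow> complex) \<Rightarrow> ('a \<Rightarrow> complex) \<Rightarrow> real" where
  "mult_norm H ip w = Inf {C. 0 \<le> C \<and> (\<forall>f\<in>H. hnorm ip (\<lambda>x. w x * f x) \<le> C * hnorm ip f)}"

definition mult_separable ::
  "'a topology \<Rightarrow> ('a \<Rightarrow> complex) set \<Rightarrow> (('a \<Rightarrow> complex) \<Rightarrow> ('a \<Rightarrow> complex) \<Rightarrow> complex) \<Rightarrow> bool" where
  "mult_separable X H ip \<longleftrightarrow>
     (\<exists>D. countable D \<and> D \<subseteq> Mult X H ip \<and>
        (\<forall>w\<in>Mult X H ip. \<forall>e>0. \<exists>d\<in>D. mult_norm H ip (\<lambda>x. w x - d x) < e))"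

end

theory Submission
  imports Defs
begin

text \<open>
  Scaling reduces to a multiplier v of norm 1 with sup |v| = 1. Then |v| < 1 everywhere: if
  |v(x)| = 1, uniqueness of the element of least norm among the functions equal to 1 at x makes
  v constant near x, hence constant on the connected space. Choose points x n at which
  1 - |v| decreases geometrically. For every set S of indices the Blaschke product with zeros
  v(x n), n in S, composed with v, is a multiplier of norm at most 1: each factor is a
  contraction by a direct computation, and a bounded pointwise limit of elements of the Hilbert
  space stays in it. The composite vanishes at x n for n in S and has modulus at least 1/2
  there otherwise. Since multiplier norms dominate sup norms, these uncountably many multipliers
  are uniformly separated.
\<close>

subsection \<open>Blaschke products with lacunary zeros\<close>

text \<open>The disc automorphism exchanging 0 and \<open>a\<close>, rotated so that its value at 0
  is \<open>cmod a\<close>. With this normalisation the factors tend to 1 as \<open>cmod a\<close>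
  tends to 1, which infinite products require. For \<open>a = 0\<close> the division makes it the
  zero function, so nonzero \<open>a\<close> is assumed below wherever it matters.\<close>

definition blaschke :: "complex \<Rightarrow> complex \<Rightarrow> complex" where
  "blaschke a z = cnj a / cmod a * ((a - z) / (1 - cnj a * z))"

lemma one_minus_cnj_mult_nz:
  assumes "cmod a < 1" "cmod z < 1" shows "1 - cnj a * z \<noteq> 0"
proof
  assume "1 - cnj a * z = 0"
  then have "cmod a * cmod z = 1" by (metis complex_mod_cnj eq_iff_diff_eq_0 norm_mult norm_one)
  moreover have "cmod a * cmod z \<le> cmod a" using assms by (simp add: mult_left_le)
  ultimately show False using assms(1) by simp
qed

lemma blaschke_self [simp]: "blaschke a a = 0"
  by (simp add: blaschke_def)

text \<open>The modulus is the pseudohyperbolic distance between \<open>a\<close> and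
  \<open>z\<close>, which is symmetric.\<close>

lemma cmod_blaschke_commute:
  assumes "a \<noteq> 0" "z \<noteq> 0" shows "cmod (blaschke a z) = cmod (blaschke z a)"
proof -
  have "cmod (1 - cnj a * z) = cmod (cnj (1 - cnj a * z))" by (simp only: complex_mod_cnj)
  also have "\<dots> = cmod (1 - cnj z * a)" by (simp add: mult.commute)
  finally show ?thesis
    using assms by (simp add: blaschke_def norm_mult norm_divide norm_minus_commute)
qed

text \<open>Over the common denominator the numerator of \<open>blaschke a z - 1\<close> splits off
  the factor \<open>cmod a - 1\<close>. The other factor is at most \<open>2 * cmod a\<close>, which
  cancels the \<open>cmod a\<close> below, so the bound does not degenerate for small
  \<open>a\<close>.\<close>

lemma blaschke_near_1:
  assumes a: "0 < cmod a" "cmod a < 1" and z: "cmod z < 1"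
  shows "cmod (blaschke a z - 1) \<le> 2 * (1 - cmod a) / (1 - cmod z)"
proof -
  let ?r = "complex_of_real (cmod a)" and ?d = "1 - cnj a * z"
  have d: "?d \<noteq> 0" using one_minus_cnj_mult_nz a z by simp
  have r: "?r \<noteq> 0" "a \<noteq> 0" using a by auto
  have sq: "a * cnj a = ?r * ?r"
    by (metis complex_norm_square power2_eq_square of_real_mult)
  have "blaschke a z - 1 = (cnj a * (a - z) - ?r * ?d) / (?r * ?d)"
    using d r unfolding blaschke_def by (simp add: divide_simps)
  also have "cnj a * (a - z) - ?r * ?d = (?r - 1) * (?r + cnj a * z)"
    by (simp add: algebra_simps sq)
  finally have "cmod (blaschke a z - 1) = cmod (?r - 1) * cmod (?r + cnj a * z) / (cmod a * cmod ?d)"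
    by (simp add: norm_mult norm_divide)
  also have "cmod (?r - 1) = 1 - cmod a"
    using a by (metis abs_minus_commute abs_of_pos diff_gt_0_iff_gt norm_of_real of_real_1 of_real_diff)
  also have "(1 - cmod a) * cmod (?r + cnj a * z) / (cmod a * cmod ?d)
      \<le> (1 - cmod a) * (2 * cmod a) / (cmod a * (1 - cmod z))"
  proof (intro frac_le mult_left_mono mult_nonneg_nonneg)
    have "cmod (cnj a * z) \<le> cmod a * 1"
      using z by (simp add: norm_mult mult_left_le)
    then show "cmod (?r + cnj a * z) \<le> 2 * cmod a"
      using norm_triangle_ineq[of ?r "cnj a * z"] by simp
    have "cmod (cnj a * z) \<le> 1 * cmod z"
      using a by (simp add: norm_mult mult_left_le_one_le)
    then show "1 - cmod z \<le> cmod ?d"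
      using norm_triangle_ineq2[of 1 "cnj a * z"] by simp
  qed (use a z in auto)
  also have "\<dots> = 2 * (1 - cmod a) / (1 - cmod z)" using a z by (simp add: frac_eq_eq)
  finally show ?thesis .
qed

text \<open>The estimate near 1 is applied twice, the second time with \<open>a\<close> and
  \<open>z\<close> exchanged, which leaves the modulus unchanged. The bound is useful whenever the
  two distances to the circle are of different size.\<close>

lemma cmod_blaschke_ge:
  assumes a: "0 < cmod a" "cmod a < 1" and z: "0 < cmod z" "cmod z < 1"
  shows "1 - 2 * min ((1 - cmod a) / (1 - cmod z)) ((1 - cmod z) / (1 - cmod a)) \<le> cmod (blaschke a z)"
proof -
  have lower: "1 - cmod (blaschke b w - 1) \<le> cmod (blaschke b w)" for b w
    using norm_triangle_ineq2[of 1 "1 - blaschke b w"] by (simp add: norm_minus_commute)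
  have "1 - 2 * ((1 - cmod a) / (1 - cmod z)) \<le> cmod (blaschke a z)"
    using blaschke_near_1[OF a z(2)] lower[of a z] by simp
  moreover have "1 - 2 * ((1 - cmod z) / (1 - cmod a)) \<le> cmod (blaschke a z)"
    using blaschke_near_1[OF z a(2)] lower[of z a] cmod_blaschke_commute[of a z] a z by force
  ultimately show ?thesis by (simp add: min_def)
qed

text \<open>On each side of \<open>n\<close> the terms are dominated by the geometric series 1/16 +
  1/256 + ..., whose sum is 1/15.\<close>

lemma lacunary_sum_le:
  fixes r :: "nat \<Rightarrow> real"
  assumes pos: "\<And>n. r n > 0" and lac: "\<And>n. r (Suc n) \<le> r n / 16"
  shows "(\<Sum>m\<le>N. if m = n then 0 else min (r m / r n) (r n / r m)) \<le> 2/15"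
proof -
  let ?g = "\<lambda>m. if m = n then 0 else min (r m / r n) (r n / r m)"
  have g0: "?g m \<ge> 0" for m using pos[of m] pos[of n] by simp
  \<comment> \<open>The induction closes because 1/15 is the fixed point of \<open>t\<close> mapped
    to \<open>(t + 1) / 16\<close>.\<close>
  have below: "(\<Sum>m<n. r n / r m) \<le> 1/15"
  proof (induction n)
    case (Suc n)
    have q: "r (Suc n) / r n \<le> 1/16" using lac[of n] pos[of n] by (simp add: field_simps)
    have "(\<Sum>m<Suc n. r (Suc n) / r m) = r (Suc n) / r n * ((\<Sum>m<n. r n / r m) + 1)"
      using pos[of n] by (simp add: sum_distrib_left distrib_left)
    also have "\<dots> \<le> 1/16 * (1/15 + 1)"
      using q Suc.IH pos by (intro mult_mono) (auto intro!: sum_nonneg add_nonneg_nonneg simp: less_imp_le)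
    finally show ?case by simp
  qed simp
  \<comment> \<open>Telescoping: lacunarity says that 15 times a term is at most the drop from its
    predecessor to it.\<close>
  have above: "(\<Sum>m\<in>{n<..n+k}. r m) \<le> (r n - r (n + k)) / 15" for k
  proof (induction k)
    case (Suc k)
    have "{n<..n + Suc k} = insert (n + Suc k) {n<..n+k}" by auto
    then show ?case using Suc.IH lac[of "n+k"] by simp
  qed simp
  \<comment> \<open>The index set may grow since the terms are nonnegative; the index
    \<open>n\<close> itself contributes 0.\<close>
  have "sum ?g {..N} \<le> sum ?g ({..<n} \<union> {n<..n+N} \<union> {n})"
    by (rule sum_mono2) (use g0 in auto)
  also have "\<dots> = sum ?g ({..<n} \<union> {n<..n+N})"
    by (rule sum.mono_neutral_right) auto
  also have "\<dots> = sum ?g {..<n} + sum ?g {n<..n+N}"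
    by (rule sum.union_disjoint) auto
  also have "\<dots> \<le> (\<Sum>m<n. r n / r m) + (\<Sum>m\<in>{n<..n+N}. r m / r n)"
    by (intro add_mono sum_mono) (auto simp: min_def)
  also have "(\<Sum>m\<in>{n<..n+N}. r m / r n) = (\<Sum>m\<in>{n<..n+N}. r m) / r n"
    by (rule sum_divide_distrib[symmetric])
  also have "\<dots> \<le> 1/15"
    using above[of N] pos[of n] pos[of "n + N"] by (simp add: divide_simps)
  finally show ?thesis using below by simp
qed

lemma lacunary_le_geometric:
  fixes r :: "nat \<Rightarrow> real"
  assumes lac: "\<And>n. r (Suc n) \<le> r n / 16"
  shows "r n \<le> r 0 * (1/16) ^ n"
proof (induction n)
  case (Suc n)
  then show ?case using lac[of n] by simp
qed simp

text \<open>Indices outside \<open>S\<close> contribute the factor 1, so one sequence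
  \<open>a\<close> serves all zero sets. The \<open>lim\<close> is a genuine limit once convergence
  is known, which is shown for \<open>cmod z < 1\<close> and lacunary \<open>a\<close>.\<close>

definition blaschke_prod :: "(nat \<Rightarrow> complex) \<Rightarrow> nat set \<Rightarrow> complex \<Rightarrow> complex" where
  "blaschke_prod a S z = lim (\<lambda>N. \<Prod>m\<le>N. if m \<in> S then blaschke (a m) z else 1)"

text \<open>The ratio 1/16 is small enough for the Weierstrass product inequality to keep a
  Blaschke product away from 0 at those points of the sequence that are not among its zeros.\<close>

locale lacunary =
  fixes a :: "nat \<Rightarrow> complex"
  assumes a_pos: "\<And>n. 0 < cmod (a n)" and a_less: "\<And>n. cmod (a n) < 1"
    and a_lac: "\<And>n. 1 - cmod (a (Suc n)) \<le> (1 - cmod (a n)) / 16"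
begin

text \<open>The distances of the factors from 1 are dominated by a geometric series whose constant
  depends on \<open>z\<close>. Pointwise convergence is enough for the later passage to
  multipliers.\<close>

lemma blaschke_prod_tendsto:
  assumes z: "cmod z < 1"
  shows "(\<lambda>N. \<Prod>m\<le>N. if m \<in> S then blaschke (a m) z else 1) \<longlonglongrightarrow> blaschke_prod a S z"
proof -
  let ?f = "\<lambda>m. if m \<in> S then blaschke (a m) z else 1"
  have "summable (\<lambda>m. norm (?f m - 1))"
  proof (rule summable_comparison_test')
    show "summable (\<lambda>m. 2 * (1 - cmod (a 0)) / (1 - cmod z) * (1/16) ^ m)"
      by (intro summable_mult summable_geometric) simp
    fix m :: nat
    have "norm (?f m - 1) \<le> 2 * (1 - cmod (a m)) / (1 - cmod z)"
      using blaschke_near_1[OF a_pos a_less z, of m] a_less[of m] z by auto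
    also have "\<dots> \<le> 2 * ((1 - cmod (a 0)) * (1/16) ^ m) / (1 - cmod z)"
      using lacunary_le_geometric[of "\<lambda>n. 1 - cmod (a n)", OF a_lac, of m] z
      by (intro divide_right_mono mult_left_mono) auto
    finally show "norm (norm (?f m - 1)) \<le> 2 * (1 - cmod (a 0)) / (1 - cmod z) * (1/16) ^ m"
      by (simp only: real_norm_def abs_norm_cancel mult.assoc times_divide_eq_left)
  qed
  then have "convergent_prod ?f"
    by (intro abs_convergent_prod_imp_convergent_prod summable_imp_abs_convergent_prod)
  then show ?thesis
    unfolding blaschke_prod_def by (simp add: convergent_LIMSEQ_iff[symmetric] convergent_prod_imp_convergent)
qed

lemma blaschke_prod_zero:
  assumes "n \<in> S" shows "blaschke_prod a S (a n) = 0"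
proof (rule LIMSEQ_unique[OF blaschke_prod_tendsto[OF a_less]])
  have "\<forall>\<^sub>F N in sequentially. (\<Prod>m\<le>N. if m \<in> S then blaschke (a m) (a n) else 1) = 0"
    using eventually_ge_at_top[of n] by eventually_elim (use assms in force)
  then show "(\<lambda>N. \<Prod>m\<le>N. if m \<in> S then blaschke (a m) (a n) else 1) \<longlonglongrightarrow> 0"
    by (rule tendsto_eventually)
qed

text \<open>The product of the numbers \<open>1 - 2 * ?g m\<close> is at least 1 minus the sum of
  the subtracted terms, which is at most 4/15. Setting \<open>?g n = 0\<close> is legitimate because
  the factor with index \<open>n\<close> is 1.\<close>

lemma blaschke_prod_large:
  assumes "n \<notin> S" shows "1/2 \<le> cmod (blaschke_prod a S (a n))"
proof -
  let ?r = "\<lambda>n. 1 - cmod (a n)"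
  let ?g = "\<lambda>m. if m = n then 0 else min (?r m / ?r n) (?r n / ?r m)"
  have pos: "?r m > 0" for m using a_less[of m] by simp
  have sum: "sum ?g {..N} \<le> 2/15" for N
    by (rule lacunary_sum_le) (use pos a_lac in auto)
  have g0: "?g m \<ge> 0" for m using pos[of m] pos[of n] by simp
  have g1: "?g m \<le> 1/2" for m
    using sum[of m] member_le_sum[of m "{..m}" ?g] g0 by force
  have "1/2 \<le> cmod (\<Prod>m\<le>N. if m \<in> S then blaschke (a m) (a n) else 1)" for N
  proof -
    have "1/2 \<le> 1 - sum (\<lambda>m. 2 * ?g m) {..N}"
      using sum[of N] by (simp only: sum_distrib_left[symmetric])
    also have "\<dots> \<le> (\<Prod>m\<le>N. 1 - 2 * ?g m)"
    proof (rule Weierstrass_prod_ineq)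
      fix m show "2 * ?g m \<in> {0..1}" using g0[of m] g1[of m] by simp
    qed
    also have "\<dots> \<le> (\<Prod>m\<le>N. cmod (if m \<in> S then blaschke (a m) (a n) else 1))"
    proof (rule prod_mono, intro conjI)
      fix m
      show "0 \<le> 1 - 2 * ?g m" using g1[of m] by simp
      show "1 - 2 * ?g m \<le> cmod (if m \<in> S then blaschke (a m) (a n) else 1)"
        using cmod_blaschke_ge[OF a_pos a_less a_pos a_less, of m n] assms g0[of m] by auto
    qed
    finally show ?thesis by (simp only: prod_norm)
  qed
  then show ?thesis
    by (intro LIMSEQ_le_const[OF tendsto_norm[OF blaschke_prod_tendsto[OF a_less]]]) blast
qed

end

subsection \<open>Hilbert spaces of functions\<close>

lemma clopen_eq_topspace:
  assumes "connected_space X" "openin X U" "openin X (topspace X - U)" "U \<noteq> {}"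
  shows "U = topspace X"
proof (rule ccontr)
  assume "U \<noteq> topspace X"
  then have "topspace X - U \<noteq> {}"
    using openin_subset[OF assms(2)] by blast
  then show False
    using connected_spaceD[OF assms(1-3)] assms(4) by blast
qed

text \<open>Convexity of closed discs, in the midpoint form that \<open>nested_convex\<close> asks
  for.\<close>

lemma midpoint_dist_le:
  fixes a b c :: complex
  assumes "cmod (a - c) \<le> r" "cmod (b - c) \<le> r"
  shows "cmod (1/2 * (a + b) - c) \<le> r"
proof -
  have "1/2 * (a + b) - c = 1/2 * ((a - c) + (b - c))" by (simp add: field_simps)
  then have "cmod (1/2 * (a + b) - c) = 1/2 * cmod ((a - c) + (b - c))"
    by (simp only: norm_mult) simp
  then show ?thesis using assms norm_triangle_ineq[of "a - c" "b - c"] by linarith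
qed

locale hilbert_functions =
  fixes X :: "'a topology" and H :: "('a \<Rightarrow> complex) set"
    and ip :: "('a \<Rightarrow> complex) \<Rightarrow> ('a \<Rightarrow> complex) \<Rightarrow> complex"
  assumes hilbert: "hilbert_fun_space X H ip"
begin

abbreviation hn :: "('a \<Rightarrow> complex) \<Rightarrow> real" where
  "hn \<equiv> hnorm ip"

lemma mem_continuous: "f \<in> H \<Longrightarrow> continuous_map X euclidean f"
  and mem_outside: "f \<in> H \<Longrightarrow> x \<notin> topspace X \<Longrightarrow> f x = 0"
  and mem_zero: "(\<lambda>x. 0) \<in> H"
  and mem_add: "f \<in> H \<Longrightarrow> g \<in> H \<Longrightarrow> (\<lambda>x. f x + g x) \<in> H"
  and mem_scale: "f \<in> H \<Longrightarrow> (\<lambda>x. c * f x) \<in> H"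
  and ip_add: "f \<in> H \<Longrightarrow> g \<in> H \<Longrightarrow> h \<in> H \<Longrightarrow> ip (\<lambda>x. f x + g x) h = ip f h + ip g h"
  and ip_scale: "f \<in> H \<Longrightarrow> g \<in> H \<Longrightarrow> ip (\<lambda>x. c * f x) g = c * ip f g"
  and ip_cnj: "f \<in> H \<Longrightarrow> g \<in> H \<Longrightarrow> ip g f = cnj (ip f g)"
  and ip_nonneg: "f \<in> H \<Longrightarrow> 0 \<le> Re (ip f f)"
  and ip_definite: "f \<in> H \<Longrightarrow> ip f f = 0 \<Longrightarrow> f = (\<lambda>x. 0)"
  and complete: "(\<And>n. s n \<in> H) \<Longrightarrow>
    (\<And>e. e > 0 \<Longrightarrow> \<exists>N. \<forall>m\<ge>N. \<forall>n\<ge>N. hn (\<lambda>x. s m x - s n x) < e) \<Longrightarrow>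
    \<exists>g\<in>H. (\<lambda>n. hn (\<lambda>x. s n x - g x)) \<longlonglongrightarrow> 0"
  and compact_open: "compactin X K \<Longrightarrow> open U \<Longrightarrow> f \<in> H \<Longrightarrow> f ` K \<subseteq> U \<Longrightarrow>
    \<exists>e>0. \<forall>g\<in>H. hn (\<lambda>x. g x - f x) < e \<longrightarrow> g ` K \<subseteq> U"
proof -
  note ax1 = hilbert[unfolded hilbert_fun_space_def]
  note ax2 = ax1[THEN conjunct2]
  note ax3 = ax2[THEN conjunct2]
  note ax4 = ax3[THEN conjunct2]
  note ax5 = ax4[THEN conjunct2]
  note ax6 = ax5[THEN conjunct2]
  note ax7 = ax6[THEN conjunct2]
  note ax8 = ax7[THEN conjunct2]
  note ax9 = ax8[THEN conjunct2]
  note ax10 = ax9[THEN conjunct2]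
  show "f \<in> H \<Longrightarrow> continuous_map X euclidean f" "f \<in> H \<Longrightarrow> x \<notin> topspace X \<Longrightarrow> f x = 0"
    using ax1[THEN conjunct1] by auto
  show "(\<lambda>x. 0) \<in> H"
    by (rule ax2[THEN conjunct1])
  show "f \<in> H \<Longrightarrow> g \<in> H \<Longrightarrow> (\<lambda>x. f x + g x) \<in> H"
    by (rule ax3[THEN conjunct1, rule_format])
  show "f \<in> H \<Longrightarrow> (\<lambda>x. c * f x) \<in> H"
    by (rule ax4[THEN conjunct1, rule_format])
  show "f \<in> H \<Longrightarrow> g \<in> H \<Longrightarrow> h \<in> H \<Longrightarrow> ip (\<lambda>x. f x + g x) h = ip f h + ip g h"
    by (rule ax5[THEN conjunct1, rule_format])
  show "f \<in> H \<Longrightarrow> g \<in> H \<Longrightarrow> ip (\<lambda>x. c * f x) g = c * ip f g"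
    by (rule ax6[THEN conjunct1, rule_format])
  show "f \<in> H \<Longrightarrow> g \<in> H \<Longrightarrow> ip g f = cnj (ip f g)"
    by (rule ax7[THEN conjunct1, rule_format])
  show "f \<in> H \<Longrightarrow> 0 \<le> Re (ip f f)"
    by (rule ax8[THEN conjunct1, rule_format])
  show "f \<in> H \<Longrightarrow> ip f f = 0 \<Longrightarrow> f = (\<lambda>x. 0)"
    by (rule ax9[THEN conjunct1, rule_format])
  show "(\<And>n. s n \<in> H) \<Longrightarrow>
    (\<And>e. e > 0 \<Longrightarrow> \<exists>N. \<forall>m\<ge>N. \<forall>n\<ge>N. hn (\<lambda>x. s m x - s n x) < e) \<Longrightarrow>
    \<exists>g\<in>H. (\<lambda>n. hn (\<lambda>x. s n x - g x)) \<longlonglongrightarrow> 0"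
    by (rule ax10[THEN conjunct1, rule_format])
  show "compactin X K \<Longrightarrow> open U \<Longrightarrow> f \<in> H \<Longrightarrow> f ` K \<subseteq> U \<Longrightarrow>
    \<exists>e>0. \<forall>g\<in>H. hn (\<lambda>x. g x - f x) < e \<longrightarrow> g ` K \<subseteq> U"
    by (rule ax10[THEN conjunct2, rule_format])
qed

section \<open>Inner product calculus up to the Cauchy-Schwarz and triangle inequalities\<close>

lemma mem_diff: "f \<in> H \<Longrightarrow> g \<in> H \<Longrightarrow> (\<lambda>x. f x - g x) \<in> H"
  using mem_add[of f "\<lambda>x. - 1 * g x"] mem_scale[of g "-1"] by simp

lemma hn_nonneg: "f \<in> H \<Longrightarrow> 0 \<le> hn f"
  by (simp add: hnorm_def ip_nonneg)

lemma hn_sq: "f \<in> H \<Longrightarrow> (hn f)\<^sup>2 = Re (ip f f)"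
  by (simp add: hnorm_def ip_nonneg)

lemma hn_scale:
  assumes "f \<in> H" shows "hn (\<lambda>x. c * f x) = cmod c * hn f"
proof -
  have "ip (\<lambda>x. c * f x) (\<lambda>x. c * f x) = c * cnj c * cnj (ip f f)"
    using assms by (simp add: ip_scale mem_scale ip_cnj[of "\<lambda>x. c * f x" f])
  also have "\<dots> = (cmod c)\<^sup>2 * cnj (ip f f)"
    by (metis complex_norm_square)
  finally have "Re (ip (\<lambda>x. c * f x) (\<lambda>x. c * f x)) = (cmod c)\<^sup>2 * Re (ip f f)"
    by simp
  then show ?thesis
    by (simp add: hnorm_def real_sqrt_mult)
qed

text \<open>The common source of the parallelogram law, the Cauchy-Schwarz and triangle
  inequalities, and the norm identity behind \<open>contractive_blaschke\<close>.\<close>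

lemma hn_add_scale_sq:
  assumes "f \<in> H" "g \<in> H"
  shows "(hn (\<lambda>x. f x + c * g x))\<^sup>2 = (hn f)\<^sup>2 + 2 * Re (cnj c * ip f g) + (cmod c)\<^sup>2 * (hn g)\<^sup>2"
proof -
  let ?g = "\<lambda>x. c * g x" and ?h = "\<lambda>x. f x + c * g x"
  have m: "?g \<in> H" "?h \<in> H"
    using assms mem_scale mem_add[of f ?g] by auto
  have "ip ?h ?h = ip f ?h + ip ?g ?h"
    using ip_add[of f ?g ?h] assms m by simp
  also have "ip f ?h = cnj (ip f f + ip ?g f)"
    using ip_cnj[of ?h f] ip_add[of f ?g f] assms m by simp
  also have "ip ?g ?h = cnj (ip f ?g + ip ?g ?g)"
    using ip_cnj[of ?h ?g] ip_add[of f ?g ?g] assms m by simp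
  finally have "Re (ip ?h ?h) = (hn f)\<^sup>2 + Re (ip ?g f) + Re (ip f ?g) + (hn ?g)\<^sup>2"
    using assms m by (simp add: hn_sq)
  also have "ip f ?g = cnj c * ip f g"
    using ip_cnj[of ?g f] ip_scale[of g f c] ip_cnj[of f g] assms m by simp
  also have "ip ?g f = cnj (cnj c * ip f g)"
    using ip_scale[of g f c] ip_cnj[of f g] assms by simp
  finally show ?thesis
    using assms m by (simp add: hn_sq[of ?h] hn_scale power_mult_distrib del: complex_cnj_mult)
qed

lemma parallelogram:
  assumes "f \<in> H" "g \<in> H"
  shows "(hn (\<lambda>x. f x + g x))\<^sup>2 + (hn (\<lambda>x. f x - g x))\<^sup>2 = 2 * (hn f)\<^sup>2 + 2 * (hn g)\<^sup>2"
  using hn_add_scale_sq[OF assms, of 1] hn_add_scale_sq[OF assms, of "-1"] by simp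

lemma hn_eq_0: assumes "f \<in> H" "hn f = 0" shows "f = (\<lambda>x. 0)"
proof -
  have "Re (ip f f) = 0" using hn_sq assms by fastforce
  moreover have "Im (ip f f) = 0" using ip_cnj[of f f] assms(1) by (simp add: complex_eq_iff)
  ultimately show ?thesis using ip_definite assms(1) by (simp add: complex_eq_iff)
qed

lemma Re_ip_le:
  assumes "f \<in> H" "g \<in> H" shows "Re (ip f g) \<le> hn f * hn g"
proof (cases "hn g = 0")
  case True
  then have "g = (\<lambda>x. 0 * g x)" using hn_eq_0 assms by simp
  then have "ip g f = 0"
    using ip_scale[of g f 0] assms by simp
  then show ?thesis using ip_cnj[of g f] assms True by simp
next
  case False
  let ?r = "Re (ip f g)" and ?b = "(hn g)\<^sup>2"
  have b: "?b > 0" using False by simp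
  \<comment> \<open>The real scalar that minimises the norm of \<open>f + c * g\<close>.\<close>
  let ?c = "complex_of_real (- ?r / ?b)"
  have "0 \<le> (hn (\<lambda>x. f x + ?c * g x))\<^sup>2" by simp
  also have "\<dots> = (hn f)\<^sup>2 - 2 * (?r / ?b) * ?r + (?r / ?b)\<^sup>2 * ?b"
    unfolding hn_add_scale_sq[OF assms] by (simp add: power_divide norm_divide norm_power)
  also have "\<dots> = (hn f)\<^sup>2 - ?r\<^sup>2 / ?b"
    using False by (simp add: field_simps power2_eq_square)
  finally have "?r\<^sup>2 \<le> (hn f)\<^sup>2 * ?b"
    using b by (simp add: field_simps)
  then have "?r\<^sup>2 \<le> (hn f * hn g)\<^sup>2" by (simp add: power_mult_distrib)
  then show ?thesis
    by (rule power2_le_imp_le) (simp add: hn_nonneg assms)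
qed

lemma hn_triangle:
  assumes "f \<in> H" "g \<in> H" shows "hn (\<lambda>x. f x + g x) \<le> hn f + hn g"
proof (rule power2_le_imp_le)
  show "(hn (\<lambda>x. f x + g x))\<^sup>2 \<le> (hn f + hn g)\<^sup>2"
    using hn_add_scale_sq[OF assms, of 1] Re_ip_le[OF assms] by (simp add: power2_sum)
qed (simp add: hn_nonneg assms)

text \<open>The comparison with the compact-open topology, applied to the compact set
  \<open>{x}\<close> and the unit disc, gives continuity of evaluation at the zero function; scaling
  turns this into a linear bound.\<close>

lemma eval_bounded:
  assumes "x \<in> topspace X"
  obtains A where "A > 0" "\<And>g. g \<in> H \<Longrightarrow> cmod (g x) \<le> A * hn g"
proof -
  obtain e where e: "e > 0"
    "\<And>g. g \<in> H \<Longrightarrow> hn (\<lambda>x. g x - 0) < e \<Longrightarrow> g ` {x} \<subseteq> ball 0 1"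
    using compact_open[of "{x}" "ball 0 1" "\<lambda>x. 0"] assms mem_zero by auto
  have "cmod (g x) \<le> 2 / e * hn g" if g: "g \<in> H" for g
  proof (cases "hn g = 0")
    case True
    then show ?thesis using hn_eq_0[OF g] by simp
  next
    case False
    then have pos: "hn g > 0" using hn_nonneg[OF g] by simp
    let ?c = "complex_of_real (e / (2 * hn g))"
    have "hn (\<lambda>x. ?c * g x) = e / 2"
      using pos e(1) by (simp add: hn_scale g norm_mult norm_divide del: of_real_divide of_real_mult)
    then have "cmod (?c * g x) < 1"
      using e(2)[OF mem_scale[OF g, of ?c]] e(1) by simp
    then show ?thesis
      using pos e(1) by (simp add: norm_mult norm_divide field_simps)
  qed
  then show thesis using that[of "2 / e"] e(1) by simp
qed

text \<open>Elements of almost minimal norm in a decreasing sequence of convex sets form a Cauchy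
  sequence by the parallelogram law.\<close>

lemma nested_convex:
  assumes sub: "\<And>n. S n \<subseteq> H" and dec: "\<And>n. S (Suc n) \<subseteq> S n"
    and mid: "\<And>n f g. f \<in> S n \<Longrightarrow> g \<in> S n \<Longrightarrow> (\<lambda>x. 1/2 * (f x + g x)) \<in> S n"
    and bd: "\<And>n e. e > 0 \<Longrightarrow> \<exists>f\<in>S n. hn f < C + e"
  obtains s g where "\<And>n. s n \<in> S n" "g \<in> H" "hn g \<le> C" "\<And>x. (\<lambda>n. s n x) \<longlonglongrightarrow> g x"
proof -
  \<comment> \<open>The least norms increase because the sets shrink, and they are bounded by
    \<open>C\<close>, so they converge.\<close>
  define d where "d n = Inf (hn ` S n)" for n
  have bdd: "bdd_below (hn ` S n)" for n
    by (rule bdd_belowI[of _ 0]) (use hn_nonneg sub in blast)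
  have ne: "S n \<noteq> {}" for n using bd[of 1 n] by auto
  have d_le: "d n \<le> hn f" if "f \<in> S n" for n f
    unfolding d_def using that bdd by (simp add: cInf_lower)
  have d0: "d n \<ge> 0" for n
    unfolding d_def using ne by (intro cInf_greatest) (use hn_nonneg sub in blast)+
  have dC: "d n \<le> C" for n
  proof (rule field_le_epsilon)
    fix e :: real assume "e > 0"
    then obtain f where "f \<in> S n" "hn f < C + e" using bd by blast
    then show "d n \<le> C + e" using d_le by fastforce
  qed
  have "incseq d"
    unfolding d_def by (intro incseq_SucI cInf_superset_mono image_mono dec bdd) (simp add: ne)
  then obtain L where L: "d \<longlonglongrightarrow> L" "\<And>n. d n \<le> L"
    using incseq_convergent[of d C] dC by blast
  have LC: "L \<le> C" using LIMSEQ_le_const2[OF L(1)] dC by blast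
  define e where "e n = inverse (real (Suc n))" for n
  have e0: "e n > 0" for n by (simp add: e_def)
  have elim: "e \<longlonglongrightarrow> 0" unfolding e_def by (rule LIMSEQ_inverse_real_of_nat)
  have "\<exists>f\<in>S n. hn f < d n + e n" for n
    using cInf_lessD[of "hn ` S n" "d n + e n"] ne e0[of n] unfolding d_def by auto
  then obtain s where s: "\<And>n. s n \<in> S n" "\<And>n. hn (s n) < d n + e n" by metis
  have sH: "s n \<in> H" for n using s(1) sub by blast
  have anti: "S m \<subseteq> S n" if "n \<le> m" for m n
    using decseqD[of S n m] that dec by (simp add: decseq_Suc_iff)
  \<comment> \<open>This is what the parallelogram law leaves: two summands of norm at most
    \<open>L + e n\<close>, whose midpoint has norm at least \<open>d n\<close>.\<close>
  define u where "u n = 4 * ((L + e n)\<^sup>2 - (d n)\<^sup>2)" for n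
  have "u \<longlonglongrightarrow> 4 * ((L + 0)\<^sup>2 - L\<^sup>2)"
    unfolding u_def by (intro tendsto_intros elim L)
  then have u0: "u \<longlonglongrightarrow> 0" by simp
  have key: "(hn (\<lambda>x. s m x - s n x))\<^sup>2 \<le> u k" if "k \<le> m" "k \<le> n" for m n k
  proof -
    have ek: "e m \<le> e k" "e n \<le> e k" using that by (auto simp: e_def)
    have h: "hn (s m) \<le> L + e k" "hn (s n) \<le> L + e k"
      using s(2)[of m] s(2)[of n] L(2)[of m] L(2)[of n] ek by linarith+
    have "d k \<le> hn (\<lambda>x. 1/2 * (s m x + s n x))"
      by (intro d_le mid) (use s(1) anti that in blast)+
    also have "\<dots> = hn (\<lambda>x. s m x + s n x) / 2"
      using hn_scale[of "\<lambda>x. s m x + s n x" "1/2"] mem_add sH by simp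
    finally have "2 * d k \<le> hn (\<lambda>x. s m x + s n x)" by simp
    then have "(2 * d k)\<^sup>2 \<le> (hn (\<lambda>x. s m x + s n x))\<^sup>2"
      using d0[of k] by (intro power_mono) auto
    moreover have "(hn (s m))\<^sup>2 \<le> (L + e k)\<^sup>2" "(hn (s n))\<^sup>2 \<le> (L + e k)\<^sup>2"
      using h hn_nonneg sH by (auto intro!: power_mono)
    ultimately show ?thesis
      using parallelogram[OF sH sH, of m n] unfolding u_def power_mult_distrib by simp
  qed
  have "\<exists>g\<in>H. (\<lambda>n. hn (\<lambda>x. s n x - g x)) \<longlonglongrightarrow> 0"
  proof (rule complete[of s])
    fix r :: real assume r: "r > 0"
    then have "eventually (\<lambda>n. u n < r\<^sup>2) sequentially"
      using u0 by (intro order_tendstoD) auto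
    then obtain k where "u k < r\<^sup>2" by (auto simp: eventually_sequentially)
    then have "\<forall>m\<ge>k. \<forall>n\<ge>k. hn (\<lambda>x. s m x - s n x) < r"
      using key r by (meson le_less_trans power2_less_imp_less less_imp_le)
    then show "\<exists>N. \<forall>m\<ge>N. \<forall>n\<ge>N. hn (\<lambda>x. s m x - s n x) < r" ..
  qed (use sH in auto)
  then obtain g where g: "g \<in> H" "(\<lambda>n. hn (\<lambda>x. s n x - g x)) \<longlonglongrightarrow> 0" by blast
  have "hn g \<le> L"
  proof (rule LIMSEQ_le_const)
    show "(\<lambda>n. d n + e n + hn (\<lambda>x. s n x - g x)) \<longlonglongrightarrow> L"
      using tendsto_add[OF tendsto_add[OF L(1) elim] g(2)] by simp
    have "hn g \<le> d n + e n + hn (\<lambda>x. s n x - g x)" for n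
    proof -
      have "hn g \<le> hn (s n) + hn (\<lambda>x. - 1 * (s n x - g x))"
        using hn_triangle[OF sH[of n] mem_scale[OF mem_diff[OF sH[of n] g(1)], of "-1"]]
        by simp
      then show ?thesis
        using s(2)[of n] unfolding hn_scale[OF mem_diff[OF sH g(1)]] by simp
    qed
    then show "\<exists>N. \<forall>n\<ge>N. hn g \<le> d n + e n + hn (\<lambda>x. s n x - g x)" by blast
  qed
  moreover have "(\<lambda>n. s n x) \<longlonglongrightarrow> g x" for x
  proof (cases "x \<in> topspace X")
    case True
    then obtain A where A: "\<And>g. g \<in> H \<Longrightarrow> cmod (g x) \<le> A * hn g" using eval_bounded by metis
    have "(\<lambda>n. s n x - g x) \<longlonglongrightarrow> 0"
    proof (rule Lim_null_comparison)
      show "(\<lambda>n. A * hn (\<lambda>x. s n x - g x)) \<longlonglongrightarrow> 0"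
        using tendsto_mult_right_zero[OF g(2)] .
      show "\<forall>\<^sub>F n in sequentially. cmod (s n x - g x) \<le> A * hn (\<lambda>x. s n x - g x)"
        using A[OF mem_diff[OF sH g(1)]] by simp
    qed
    then show ?thesis by (simp add: LIM_zero_iff)
  next
    case False
    then have "s n x = 0" "g x = 0" for n using mem_outside sH g(1) by auto
    then show ?thesis by simp
  qed
  ultimately show thesis using that s(1) g(1) LC by force
qed

text \<open>A substitute for weak compactness of balls: convex sets around the tails of the sequence
  contain elements converging in norm, and their limit can only be \<open>F\<close>.\<close>

lemma bounded_pointwise_limit:
  assumes f: "\<And>n. f n \<in> H" "\<And>n. hn (f n) \<le> C" and lim: "\<And>x. (\<lambda>n. f n x) \<longlonglongrightarrow> F x"
  shows "F \<in> H" and "hn F \<le> C"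
proof -
  \<comment> \<open>In place of the convex hull of the tail: at each point, \<open>g\<close> lies in
    every closed disc about \<open>F x\<close> that contains the tail. So \<open>f n\<close> belongs
    to \<open>S n\<close>, midpoints stay in \<open>S n\<close>, and any selection from these sets
    converges pointwise to \<open>F\<close>.\<close>
  define S where "S n = {g \<in> H. \<forall>x r. (\<forall>m\<ge>n. cmod (f m x - F x) \<le> r) \<longrightarrow> cmod (g x - F x) \<le> r}" for n
  obtain s g where sg: "\<And>n. s n \<in> S n" "g \<in> H" "hn g \<le> C" "\<And>x. (\<lambda>n. s n x) \<longlonglongrightarrow> g x"
  proof (rule nested_convex[of S])
    fix n show "S n \<subseteq> H" "S (Suc n) \<subseteq> S n" unfolding S_def by auto
  next
    fix n g h assume "g \<in> S n" "h \<in> S n"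
    then show "(\<lambda>x. 1/2 * (g x + h x)) \<in> S n"
      using mem_scale[OF mem_add, of g h "1/2"] unfolding S_def
      by (auto intro!: midpoint_dist_le simp del: times_divide_eq_left mult_1)
  next
    fix n and e :: real assume "e > 0"
    then show "\<exists>g\<in>S n. hn g < C + e"
      using f(1)[of n] f(2)[of n] by (intro bexI[of _ "f n"]) (auto simp: S_def)
  qed metis
  have "g x = F x" for x
  proof (rule LIMSEQ_unique[OF sg(4)[of x]])
    show "(\<lambda>n. s n x) \<longlonglongrightarrow> F x"
    proof (rule LIMSEQ_I)
      fix r :: real assume "r > 0"
      then obtain N where N: "\<forall>m\<ge>N. cmod (f m x - F x) < r/2"
        using LIMSEQ_D[OF lim[of x], of "r/2"] by auto
      have "cmod (s n x - F x) \<le> r/2" if "n \<ge> N" for n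
      proof -
        have "\<forall>m\<ge>n. cmod (f m x - F x) \<le> r/2" using N that by (meson less_imp_le order_trans)
        then show ?thesis using sg(1)[of n] unfolding S_def by blast
      qed
      then show "\<exists>no. \<forall>n\<ge>no. cmod (s n x - F x) < r" using \<open>r > 0\<close> by force
    qed
  qed
  then have "g = F" by blast
  then show "F \<in> H" "hn F \<le> C" using sg by auto
qed

text \<open>Existence is \<open>nested_convex\<close> for a constant sequence of sets, pointwise
  convergence preserving the value 1 at \<open>x0\<close>. Uniqueness is the parallelogram
  law.\<close>

lemma exists_min_norm:
  assumes "f0 \<in> H" "f0 x0 \<noteq> 0"
  obtains k where "k \<in> H" "k x0 = 1"
    "\<And>h. h \<in> H \<Longrightarrow> h x0 = 1 \<Longrightarrow> hn h \<le> hn k \<Longrightarrow> h = k"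
proof -
  define S where "S = {f \<in> H. f x0 = 1}"
  define C where "C = Inf (hn ` S)"
  have bdd: "bdd_below (hn ` S)"
    by (rule bdd_belowI[of _ 0]) (auto simp: S_def hn_nonneg)
  have C_le: "C \<le> hn f" if "f \<in> S" for f
    unfolding C_def using that bdd by (simp add: cInf_lower)
  have ne: "S \<noteq> {}"
    using mem_scale[OF assms(1), of "1 / f0 x0"] assms(2) by (auto simp: S_def)
  have mid: "(\<lambda>x. 1/2 * (f x + g x)) \<in> S" if "f \<in> S" "g \<in> S" for f g
    using that mem_scale[OF mem_add, of f g "1/2"] by (auto simp: S_def)
  obtain s k where k: "\<And>n. s n \<in> S" "k \<in> H" "hn k \<le> C" "\<And>x. (\<lambda>n. s n x) \<longlonglongrightarrow> k x"
  proof (rule nested_convex[of "\<lambda>_. S" C])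
    fix e :: real assume "e > 0"
    then show "\<exists>f\<in>S. hn f < C + e"
      using cInf_lessD[of "hn ` S" "C + e"] ne unfolding C_def by auto
  qed (use mid S_def in auto)
  have "s n x0 = 1" for n using k(1) by (simp add: S_def)
  then have "k x0 = 1" using k(4)[of x0] LIMSEQ_unique[OF _ tendsto_const] by fastforce
  then have kS: "k \<in> S" using k by (simp add: S_def)
  have "h = k" if "h \<in> H" "h x0 = 1" "hn h \<le> hn k" for h
  proof -
    have hS: "h \<in> S" using that by (simp add: S_def)
    have hC: "hn h = C" "hn k = C" using that k(3) C_le[OF kS] C_le[OF hS] by auto
    have "C \<le> hn (\<lambda>x. 1/2 * (h x + k x))"
      by (intro C_le mid hS kS)
    also have "\<dots> = hn (\<lambda>x. h x + k x) / 2"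
      using hn_scale[of "\<lambda>x. h x + k x" "1/2"] mem_add that(1) k(2) by simp
    finally have "(2 * C)\<^sup>2 \<le> (hn (\<lambda>x. h x + k x))\<^sup>2"
      using hn_nonneg[OF k(2)] hC by (intro power_mono) auto
    \<comment> \<open>Both functions have the least norm \<open>C\<close> and their midpoint is no
      shorter, which leaves nothing for the difference.\<close>
    then have "(hn (\<lambda>x. h x - k x))\<^sup>2 \<le> 0"
      using parallelogram[OF that(1) k(2)] unfolding hC power_mult_distrib power2_eq_square[of "2 :: real"]
      by linarith
    then have "hn (\<lambda>x. h x - k x) = 0"
      by (metis power2_less_eq_zero_iff)
    then have "(\<lambda>x. h x - k x) = (\<lambda>x. 0)"
      by (rule hn_eq_0[OF mem_diff[OF that(1) k(2)]])
    then show ?thesis by (metis eq_iff_diff_eq_0 ext)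
  qed
  then show thesis using that k(2) \<open>k x0 = 1\<close> by blast
qed

end

subsection \<open>Multipliers\<close>

context hilbert_functions
begin

text \<open>Unlike in \<open>Mult\<close>, the values of \<open>m\<close> outside X are
  unrestricted. This admits the constant 1 and keeps products and compositions free of case
  distinctions.\<close>

definition contractive :: "('a \<Rightarrow> complex) \<Rightarrow> bool" where
  "contractive m \<longleftrightarrow> (\<forall>f\<in>H. (\<lambda>x. m x * f x) \<in> H \<and> hn (\<lambda>x. m x * f x) \<le> hn f)"

lemma contractive_one: "contractive (\<lambda>x. 1)"
  by (simp add: contractive_def)

lemma contractive_mult:
  assumes "contractive m" "contractive n" shows "contractive (\<lambda>x. m x * n x)"
  unfolding contractive_def
proof
  fix f assume "f \<in> H"
  then have "(\<lambda>x. n x * f x) \<in> H" "hn (\<lambda>x. n x * f x) \<le> hn f"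
    using assms(2) by (auto simp: contractive_def)
  then have "(\<lambda>x. m x * (n x * f x)) \<in> H" "hn (\<lambda>x. m x * (n x * f x)) \<le> hn f"
    using assms(1) order_trans unfolding contractive_def by blast+
  then show "(\<lambda>x. m x * n x * f x) \<in> H \<and> hn (\<lambda>x. m x * n x * f x) \<le> hn f"
    by (simp add: mult.assoc)
qed

lemma contractive_prod:
  assumes "finite I" "\<And>i. i \<in> I \<Longrightarrow> contractive (m i)"
  shows "contractive (\<lambda>x. \<Prod>i\<in>I. m i x)"
  using assms by (induction I rule: finite_induct) (auto intro: contractive_one contractive_mult)

text \<open>For fixed \<open>f\<close> the products \<open>m n * f\<close> have norm at most
  \<open>hn f\<close>, so \<open>bounded_pointwise_limit\<close> applies. Convergence on X suffices
  since \<open>f\<close> vanishes elsewhere.\<close>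

lemma contractive_limit:
  assumes m: "\<And>n. contractive (m n)" and lim: "\<And>x. x \<in> topspace X \<Longrightarrow> (\<lambda>n. m n x) \<longlonglongrightarrow> M x"
  shows "contractive M"
  unfolding contractive_def
proof
  fix f assume f: "f \<in> H"
  have "(\<lambda>n. m n x * f x) \<longlonglongrightarrow> M x * f x" for x
  proof (cases "x \<in> topspace X")
    case True
    then show ?thesis by (intro tendsto_intros lim)
  next
    case False
    then show ?thesis using mem_outside[OF f] by simp
  qed
  then show "(\<lambda>x. M x * f x) \<in> H \<and> hn (\<lambda>x. M x * f x) \<le> hn f"
    using bounded_pointwise_limit[of "\<lambda>n x. m n x * f x" "hn f" "\<lambda>x. M x * f x"] m f
    unfolding contractive_def by blast
qed

text \<open>Power trick: multiplying \<open>f\<close> by \<open>w\<close> repeatedly and evaluating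
  at \<open>x\<close> bounds all powers of \<open>cmod (w x) / C\<close> by one constant.\<close>

lemma multiplier_bound:
  assumes m: "\<And>f. f \<in> H \<Longrightarrow> (\<lambda>x. w x * f x) \<in> H \<and> hn (\<lambda>x. w x * f x) \<le> C * hn f"
    and C: "C > 0" and x: "x \<in> topspace X" and f: "f \<in> H" "f x \<noteq> 0"
  shows "cmod (w x) \<le> C"
proof (rule ccontr)
  assume "\<not> cmod (w x) \<le> C"
  then have gt: "cmod (w x) / C > 1" using C by simp
  obtain A where A: "A > 0" "\<And>g. g \<in> H \<Longrightarrow> cmod (g x) \<le> A * hn g" using eval_bounded x by metis
  have pw: "(\<lambda>x. w x ^ n * f x) \<in> H \<and> hn (\<lambda>x. w x ^ n * f x) \<le> C ^ n * hn f" for n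
  proof (induction n)
    case (Suc n)
    have "hn (\<lambda>x. w x * (w x ^ n * f x)) \<le> C * (C ^ n * hn f)"
      using m[of "\<lambda>x. w x ^ n * f x"] Suc.IH C by (meson less_imp_le mult_left_mono order_trans)
    then show ?case using m[of "\<lambda>x. w x ^ n * f x"] Suc.IH by (simp add: mult.assoc)
  qed (use f in simp)
  obtain n where n: "(cmod (w x) / C) ^ n > A * hn f / cmod (f x)"
    using real_arch_pow[OF gt] by blast
  have "cmod (w x) ^ n * cmod (f x) \<le> A * hn (\<lambda>x. w x ^ n * f x)"
    using A(2)[of "\<lambda>x. w x ^ n * f x"] pw[of n] by (simp add: norm_mult norm_power)
  also have "\<dots> \<le> A * (C ^ n * hn f)" using pw[of n] A(1) by simp
  finally have "(cmod (w x) / C) ^ n \<le> A * hn f / cmod (f x)"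
    using f(2) C by (simp add: field_simps power_divide)
  then show False using n by simp
qed

text \<open>Put \<open>h = f / (1 - cnj a * v)\<close> and \<open>g = (v - a) * h\<close>. Expanding
  the squares, the cross terms agree, and the squared norm of \<open>f\<close> minus that of
  \<open>g\<close> equals \<open>1 - (cmod a)^2\<close> times the squared norm of \<open>h\<close>
  minus that of \<open>v * h\<close>, which is nonnegative. Up to a unimodular constant
  \<open>g\<close> is the product to be estimated.\<close>

lemma contractive_blaschke:
  assumes v: "contractive v" and v1: "\<And>x. x \<in> topspace X \<Longrightarrow> cmod (v x) < 1"
    and a: "0 < cmod a" "cmod a < 1"
  shows "contractive (\<lambda>x. blaschke a (v x))"
  unfolding contractive_def
proof
  fix f assume f: "f \<in> H"
  define h where "h x = f x / (1 - cnj a * v x)" for x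
  \<comment> \<open>The \<open>n\<close>-th partial sum of the Neumann series for \<open>h\<close>,
    started at 0. Uniform norm bounds and pointwise convergence then place \<open>h\<close> in
    \<open>H\<close>.\<close>
  define s where "s n = ((\<lambda>g x. f x + cnj a * (v x * g x)) ^^ n) (\<lambda>x. 0)" for n
  have s_Suc: "s (Suc n) = (\<lambda>x. f x + cnj a * (v x * s n x))" for n by (simp add: s_def)
  have nz: "1 - cnj a * v x \<noteq> 0" if "x \<in> topspace X" for x
    using one_minus_cnj_mult_nz a v1 that by simp
  have f_eq: "f x = h x - cnj a * (v x * h x)" for x
  proof (cases "x \<in> topspace X")
    case True
    then show ?thesis using nz[of x] by (simp add: h_def divide_simps) (simp add: algebra_simps)
  next
    case False
    then show ?thesis using mem_outside[OF f] by (simp add: h_def)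
  qed
  have s_eq: "s n x = (1 - (cnj a * v x) ^ n) * h x" for n x
  proof (induction n)
    case (Suc n)
    have "s (Suc n) x = h x - cnj a * (v x * h x) + cnj a * (v x * ((1 - (cnj a * v x) ^ n) * h x))"
      unfolding Suc.IH[symmetric] f_eq[of x, symmetric] by (simp add: s_Suc)
    then show ?case by (simp add: algebra_simps)
  qed (simp add: s_def)
  \<comment> \<open>The bound is the fixed point of the recursion \<open>t\<close> mapped to
    \<open>hn f + cmod a * t\<close>.\<close>
  have s_bound: "s n \<in> H \<and> hn (s n) \<le> hn f / (1 - cmod a)" for n
  proof (induction n)
    case 0
    have "hn (\<lambda>x. 0) = 0" using hn_scale[OF f, of 0] by simp
    then show ?case using mem_zero hn_nonneg[OF f] a by (simp add: s_def)
  next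
    case (Suc n)
    then have vs: "(\<lambda>x. v x * s n x) \<in> H" "hn (\<lambda>x. v x * s n x) \<le> hn (s n)"
      using v by (auto simp: contractive_def)
    have "hn (s (Suc n)) \<le> hn f + cmod a * hn (\<lambda>x. v x * s n x)"
      using hn_triangle[OF f mem_scale[OF vs(1), of "cnj a"]] hn_scale[OF vs(1), of "cnj a"]
      by (simp add: s_Suc)
    also have "\<dots> \<le> hn f + cmod a * (hn f / (1 - cmod a))"
      using vs(2) Suc.IH a by (intro add_left_mono mult_left_mono) auto
    also have "\<dots> = hn f / (1 - cmod a)" using a by (simp add: field_simps)
    finally show ?case using mem_add[OF f mem_scale[OF vs(1)]] by (simp add: s_Suc)
  qed
  have "(\<lambda>n. s n x) \<longlonglongrightarrow> h x" for x
  proof (cases "x \<in> topspace X")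
    case True
    have "cmod (cnj a * v x) \<le> cmod a"
      using v1[OF True] by (simp add: norm_mult mult_left_le)
    then have "(\<lambda>n. (cnj a * v x) ^ n) \<longlonglongrightarrow> 0"
      using LIMSEQ_power_zero[OF le_less_trans] a(2) by blast
    then have "(\<lambda>n. (1 - (cnj a * v x) ^ n) * h x) \<longlonglongrightarrow> (1 - 0) * h x"
      by (intro tendsto_mult tendsto_diff tendsto_const)
    then show ?thesis by (simp add: s_eq)
  next
    case False
    then have "s n x = 0" "h x = 0" for n using mem_outside f by (auto simp: s_eq h_def)
    then show ?thesis by simp
  qed
  then have h: "h \<in> H" using bounded_pointwise_limit(1)[of s "hn f / (1 - cmod a)" h] s_bound by blast
  then have vh: "(\<lambda>x. v x * h x) \<in> H" "hn (\<lambda>x. v x * h x) \<le> hn h"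
    using v by (auto simp: contractive_def)
  let ?vh = "\<lambda>x. v x * h x"
  let ?g = "\<lambda>x. v x * h x + (- a) * h x"
  have g: "?g \<in> H" using mem_add[OF vh(1) mem_scale[OF h]] .
  have "f = (\<lambda>x. h x + (- cnj a) * ?vh x)" using f_eq by auto
  then have "(hn f)\<^sup>2 = (hn h)\<^sup>2 - 2 * Re (a * ip h ?vh) + (cmod a)\<^sup>2 * (hn ?vh)\<^sup>2"
    using hn_add_scale_sq[OF h vh(1), of "- cnj a"] by simp
  moreover have "(hn ?g)\<^sup>2 = (hn ?vh)\<^sup>2 - 2 * Re (cnj a * ip ?vh h) + (cmod a)\<^sup>2 * (hn h)\<^sup>2"
    using hn_add_scale_sq[OF vh(1) h, of "- a"] by simp
  moreover have "Re (cnj a * ip ?vh h) = Re (a * ip h ?vh)"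
    using ip_cnj[OF vh(1) h] by simp
  moreover have "0 \<le> (1 - (cmod a)\<^sup>2) * ((hn h)\<^sup>2 - (hn ?vh)\<^sup>2)"
    using a vh(2) hn_nonneg[OF vh(1)] by (intro mult_nonneg_nonneg) (simp_all add: power_le_one power_mono)
  ultimately have "(hn ?g)\<^sup>2 \<le> (hn f)\<^sup>2" by (simp add: algebra_simps)
  then have le: "hn ?g \<le> hn f" using power2_le_imp_le hn_nonneg[OF f] by blast
  let ?c = "- (cnj a / cmod a)"
  have eq: "(\<lambda>x. blaschke a (v x) * f x) = (\<lambda>x. ?c * ?g x)"
    by (auto simp: blaschke_def h_def fun_eq_iff mem_outside[OF f] algebra_simps diff_divide_distrib)
  have "cmod ?c = 1" using a by (simp add: norm_divide)
  then show "(\<lambda>x. blaschke a (v x) * f x) \<in> H \<and> hn (\<lambda>x. blaschke a (v x) * f x) \<le> hn f"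
    unfolding eq hn_scale[OF g] using mem_scale[OF g] le by (simp only: mult_1 simp_thms)
qed

text \<open>If k has minimal norm among the functions with k x0 = 1, then so has
  cnj (v x0) * v * k, and the two agree by uniqueness.\<close>

lemma unimodular_locally_constant:
  assumes v: "contractive v" and f: "f \<in> H" "f x0 \<noteq> 0" and v0: "cmod (v x0) = 1"
  obtains k where "k \<in> H" "k x0 = 1" "\<And>x. k x \<noteq> 0 \<Longrightarrow> v x = v x0"
proof -
  obtain k where k: "k \<in> H" "k x0 = 1"
    "\<And>h. h \<in> H \<Longrightarrow> h x0 = 1 \<Longrightarrow> hn h \<le> hn k \<Longrightarrow> h = k"
    using exists_min_norm[OF f] by metis
  have vv: "cnj (v x0) * v x0 = 1" using complex_norm_square[of "v x0"] v0 by (simp add: mult.commute)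
  have vk: "(\<lambda>x. v x * k x) \<in> H" "hn (\<lambda>x. v x * k x) \<le> hn k"
    using v k(1) by (auto simp: contractive_def)
  have "(\<lambda>x. cnj (v x0) * (v x * k x)) = k"
    by (rule k(3)) (use mem_scale[OF vk(1)] hn_scale[OF vk(1)] vk(2) vv v0 k(2) in auto)
  then have eq: "cnj (v x0) * (v x * k x) = k x" for x by (rule fun_cong)
  have "v x = v x0" if "k x \<noteq> 0" for x
  proof -
    have "cnj (v x0) * v x = cnj (v x0) * v x0"
      using eq[of x] that vv by (simp add: mult.assoc[symmetric])
    moreover have "cnj (v x0) \<noteq> 0" using v0 by auto
    ultimately show ?thesis by (simp only: mult_cancel_left simp_thms)
  qed
  then show thesis using that k(1,2) by blast
qed

text \<open>Continuity is given for elements of \<open>H\<close>, not for multipliers, so open sets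
  are produced from the former.\<close>

lemma openin_nonzero:
  assumes "f \<in> H" shows "openin X {x \<in> topspace X. f x \<noteq> 0}"
proof -
  have "openin X {x \<in> topspace X. f x \<in> - {0}}"
    by (rule openin_continuous_map_preimage[OF mem_continuous[OF assms]]) (simp add: open_Compl)
  then show ?thesis by simp
qed

lemma contractive_less_1:
  assumes X: "connected_space X" and ind: "one_independent X H" and v: "contractive v"
    and le: "cmod (v x0) \<le> 1" and x0: "x0 \<in> topspace X"
    and y: "y \<in> topspace X" "z \<in> topspace X" "v y \<noteq> v z"
  shows "cmod (v x0) < 1"
proof (rule ccontr)
  assume "\<not> cmod (v x0) < 1"
  then have v0: "cmod (v x0) = 1" using le by simp
  let ?U = "{x \<in> topspace X. v x = v x0}"
  have "\<exists>T. openin X T \<and> x \<in> T \<and> T \<subseteq> ?U" if x: "x \<in> ?U" for x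
  proof -
    obtain f where f: "f \<in> H" "f x \<noteq> 0" using ind x by (auto simp: one_independent_def)
    have "cmod (v x) = 1" using x v0 by simp
    then obtain k where k: "k \<in> H" "k x = 1" "\<And>y. k y \<noteq> 0 \<Longrightarrow> v y = v x"
      using unimodular_locally_constant[OF v f] by metis
    have "y \<in> ?U" if "y \<in> topspace X" "k y \<noteq> 0" for y
      using k(3)[OF that(2)] x that(1) by simp
    moreover have "x \<in> {y \<in> topspace X. k y \<noteq> 0}" using x k(2) by simp
    ultimately show ?thesis using openin_nonzero[OF k(1)] by blast
  qed
  then have "openin X ?U" by (subst openin_subopen) blast
  moreover have "\<exists>T. openin X T \<and> x \<in> T \<and> T \<subseteq> topspace X - ?U" if x: "x \<in> topspace X - ?U" for x
  proof -
    obtain f where f: "f \<in> H" "f x \<noteq> 0" using ind x by (auto simp: one_independent_def)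
    \<comment> \<open>An element of \<open>H\<close> that vanishes on \<open>?U\<close> but not at
      \<open>x\<close>; it replaces continuity of \<open>v\<close>.\<close>
    let ?g = "\<lambda>x. v x * f x - v x0 * f x"
    have "?g \<in> H"
      by (rule mem_diff[OF _ mem_scale]) (use v f in \<open>auto simp: contractive_def\<close>)
    then have "openin X {y \<in> topspace X. ?g y \<noteq> 0}" by (rule openin_nonzero)
    moreover have "x \<in> {y \<in> topspace X. ?g y \<noteq> 0}" using x f by simp
    moreover have "{y \<in> topspace X. ?g y \<noteq> 0} \<subseteq> topspace X - ?U" by auto
    ultimately show ?thesis by blast
  qed
  then have "openin X (topspace X - ?U)" by (subst openin_subopen) blast
  ultimately have "?U = topspace X" using clopen_eq_topspace[OF X] x0 by blast
  then have "v u = v x0" if "u \<in> topspace X" for u using that by blast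
  then show False using y by metis
qed

section \<open>The multiplier norm and its comparison with the sup norm\<close>

lemma Mult_bounded:
  assumes "w \<in> Mult X H ip"
  shows "{C. 0 \<le> C \<and> (\<forall>f\<in>H. hn (\<lambda>x. w x * f x) \<le> C * hn f)} \<noteq> {}"
proof -
  obtain C where C: "\<forall>f\<in>H. hn (\<lambda>x. w x * f x) \<le> C * hn f"
    using assms by (auto simp: Mult_def)
  \<comment> \<open>\<open>Mult\<close> does not ask for a nonnegative constant, while the set
    defining \<open>mult_norm\<close> does.\<close>
  have "hn (\<lambda>x. w x * f x) \<le> max 0 C * hn f" if "f \<in> H" for f
    using C that hn_nonneg[OF that] by (meson max.cobounded2 mult_right_mono order_trans)
  then have "max 0 C \<in> {C. 0 \<le> C \<and> (\<forall>f\<in>H. hn (\<lambda>x. w x * f x) \<le> C * hn f)}"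
    by (intro CollectI conjI ballI) auto
  then show ?thesis by blast
qed

lemma mult_norm_nonneg: "w \<in> Mult X H ip \<Longrightarrow> 0 \<le> mult_norm H ip w"
  unfolding mult_norm_def by (rule cInf_greatest[OF Mult_bounded]) auto

text \<open>The infimum is itself an admissible constant: for \<open>f\<close> of positive norm, the
  quotient of the two norms is a lower bound of the set of constants.\<close>

lemma hn_mult_le:
  assumes w: "w \<in> Mult X H ip" and f: "f \<in> H"
  shows "hn (\<lambda>x. w x * f x) \<le> mult_norm H ip w * hn f"
proof (cases "hn f = 0")
  case True
  then show ?thesis using hn_eq_0[OF f] by simp
next
  case False
  then have pos: "hn f > 0" using hn_nonneg[OF f] by simp
  have "hn (\<lambda>x. w x * f x) / hn f \<le> mult_norm H ip w"
    unfolding mult_norm_def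
    by (rule cInf_greatest[OF Mult_bounded[OF w]]) (use f pos in \<open>auto simp: divide_le_eq\<close>)
  then show ?thesis using pos by (simp add: divide_le_eq)
qed

lemma cmod_le_mult_norm:
  assumes w: "w \<in> Mult X H ip" and ind: "one_independent X H" and x: "x \<in> topspace X"
  shows "cmod (w x) \<le> mult_norm H ip w"
\<comment> \<open>The slack \<open>e\<close> supplies the positive constant required by
  \<open>multiplier_bound\<close>, even if the norm is 0.\<close>
proof (rule field_le_epsilon)
  fix e :: real assume e: "e > 0"
  obtain f where f: "f \<in> H" "f x \<noteq> 0" using ind x by (auto simp: one_independent_def)
  show "cmod (w x) \<le> mult_norm H ip w + e"
  proof (rule multiplier_bound[OF _ _ x f])
    fix f assume f: "f \<in> H"
    have "hn (\<lambda>x. w x * f x) \<le> (mult_norm H ip w + e) * hn f"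
      using hn_mult_le[OF w f] e hn_nonneg[OF f] by (simp add: distrib_right add_increasing2)
    then show "(\<lambda>x. w x * f x) \<in> H \<and> hn (\<lambda>x. w x * f x) \<le> (mult_norm H ip w + e) * hn f"
      using w f by (simp add: Mult_def)
  qed (use mult_norm_nonneg[OF w] e in simp)
qed

lemma Mult_diff:
  assumes u: "u \<in> Mult X H ip" and w: "w \<in> Mult X H ip"
  shows "(\<lambda>x. u x - w x) \<in> Mult X H ip"
proof -
  have m: "(\<lambda>x. u x * f x) \<in> H" "(\<lambda>x. w x * f x) \<in> H" if "f \<in> H" for f
    using u w that by (auto simp: Mult_def)
  have "hn (\<lambda>x. (u x - w x) * f x) \<le> (mult_norm H ip u + mult_norm H ip w) * hn f" if f: "f \<in> H" for f
  proof -
    have "hn (\<lambda>x. u x * f x + - 1 * (w x * f x)) \<le> hn (\<lambda>x. u x * f x) + hn (\<lambda>x. - 1 * (w x * f x))"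
      by (rule hn_triangle[OF m(1)[OF f] mem_scale[OF m(2)[OF f]]])
    also have "hn (\<lambda>x. - 1 * (w x * f x)) = hn (\<lambda>x. w x * f x)"
      using hn_scale[OF m(2)[OF f], of "-1"] by simp
    finally show ?thesis
      using hn_mult_le[OF u f] hn_mult_le[OF w f] by (simp add: algebra_simps)
  qed
  moreover have "(\<lambda>x. (u x - w x) * f x) \<in> H" if "f \<in> H" for f
    using mem_diff[OF m[OF that]] by (simp add: left_diff_distrib)
  ultimately show ?thesis using u w by (auto simp: Mult_def)
qed

text \<open>Truncation to X does not change products with elements of \<open>H\<close>, which vanish
  outside X.\<close>

lemma contractive_imp_Mult:
  assumes "contractive m" shows "(\<lambda>x. if x \<in> topspace X then m x else 0) \<in> Mult X H ip"
proof -
  have "(\<lambda>x. (if x \<in> topspace X then m x else 0) * f x) = (\<lambda>x. m x * f x)" if "f \<in> H" for f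
    using mem_outside[OF that] by auto
  then show ?thesis
    using assms by (auto simp: Mult_def contractive_def intro!: exI[of _ 1])
qed

section \<open>Uniformly separated multipliers and non-separability\<close>

lemma exists_lacunary_points:
  assumes v: "\<And>x. x \<in> topspace X \<Longrightarrow> cmod (v x) < 1"
    and near: "\<And>e. e > 0 \<Longrightarrow> \<exists>x\<in>topspace X. 1 - cmod (v x) < e"
  obtains x where "\<And>n. x n \<in> topspace X" "lacunary (\<lambda>n. v (x n))"
proof -
  have "\<exists>x. \<forall>n. (x n \<in> topspace X \<and> 0 < cmod (v (x n))) \<and>
      1 - cmod (v (x (Suc n))) \<le> (1 - cmod (v (x n))) / 16"
  \<comment> \<open>A successor satisfies \<open>1 - cmod (v y) < 1/16\<close>, so
    \<open>v y\<close> is again nonzero.\<close>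
  proof (rule dependent_nat_choice)
    show "\<exists>x. x \<in> topspace X \<and> 0 < cmod (v x)" using near[of 1] by auto
    fix x n assume x: "x \<in> topspace X \<and> 0 < cmod (v x)"
    then obtain y where "y \<in> topspace X" "1 - cmod (v y) < (1 - cmod (v x)) / 16"
      using near[of "(1 - cmod (v x)) / 16"] v by auto
    then show "\<exists>y. (y \<in> topspace X \<and> 0 < cmod (v y)) \<and> 1 - cmod (v y) \<le> (1 - cmod (v x)) / 16"
      using v[of x] x norm_ge_zero[of "v x"] by (intro exI[of _ y]) (auto simp: zero_less_norm_iff[symmetric] simp del: zero_less_norm_iff)
  qed
  then obtain x where x: "\<And>n. x n \<in> topspace X" "\<And>n. 0 < cmod (v (x n))"
    "\<And>n. 1 - cmod (v (x (Suc n))) \<le> (1 - cmod (v (x n))) / 16" by blast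
  then have "lacunary (\<lambda>n. v (x n))" using v by unfold_locales auto
  then show thesis using that x(1) by blast
qed

lemma not_separable:
  assumes ind: "one_independent X H" and v: "contractive v"
    and v1: "\<And>x. x \<in> topspace X \<Longrightarrow> cmod (v x) < 1"
    and near: "\<And>e. e > 0 \<Longrightarrow> \<exists>x\<in>topspace X. 1 - cmod (v x) < e"
  shows "\<not> mult_separable X H ip"
proof
  assume "mult_separable X H ip"
  then obtain D where D: "countable D" "D \<subseteq> Mult X H ip"
    "\<And>w e. w \<in> Mult X H ip \<Longrightarrow> e > 0 \<Longrightarrow> \<exists>d\<in>D. mult_norm H ip (\<lambda>x. w x - d x) < e"
    unfolding mult_separable_def by metis
  obtain x where x: "\<And>n. x n \<in> topspace X" and "lacunary (\<lambda>n. v (x n))"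
    using exists_lacunary_points[OF v1 near] by blast
  then interpret lacunary "\<lambda>n. v (x n)" by blast
  define P where "P S y = (if y \<in> topspace X then blaschke_prod (\<lambda>n. v (x n)) S (v y) else 0)" for S y
  have "contractive (\<lambda>y. blaschke_prod (\<lambda>n. v (x n)) S (v y))" for S
  proof (rule contractive_limit)
    show "contractive (\<lambda>y. \<Prod>m\<le>N. if m \<in> S then blaschke (v (x m)) (v y) else 1)" for N
    proof (rule contractive_prod)
      fix m
      have "contractive (\<lambda>y. blaschke (v (x m)) (v y))"
        by (rule contractive_blaschke[OF v v1 a_pos a_less])
      then show "contractive (\<lambda>y. if m \<in> S then blaschke (v (x m)) (v y) else 1)"
        using contractive_one by (cases "m \<in> S") (simp_all only: if_True if_False)
    qed simp
  qed (rule blaschke_prod_tendsto[OF v1])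
  then have PM: "P S \<in> Mult X H ip" for S
    unfolding P_def by (rule contractive_imp_Mult)
  then obtain d where d: "\<And>S. d S \<in> D" "\<And>S. mult_norm H ip (\<lambda>y. P S y - d S y) < 1/4"
    using D(3)[OF PM, of "1/4"] by (metis zero_less_divide_1_iff zero_less_numeral)
  have near_d: "cmod (P S y - d S y) < 1/4" if "y \<in> topspace X" for S y
  proof -
    have "d S \<in> Mult X H ip" using d(1) D(2) by blast
    then show ?thesis
      using cmod_le_mult_norm[OF Mult_diff[OF PM] ind that] d(2) le_less_trans by blast
  qed
  \<comment> \<open>At \<open>x n\<close> with \<open>n\<close> in \<open>S\<close> but not in
    \<open>T\<close>, the values of \<open>P S\<close> and \<open>P T\<close> differ by at least
    1/2, yet both would lie within less than 1/4 of the same number.\<close>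
  have sub: "S \<subseteq> T" if "d S = d T" for S T
  proof
    fix n assume n: "n \<in> S"
    show "n \<in> T"
    proof (rule ccontr)
      assume "n \<notin> T"
      then have "1/2 \<le> cmod (P T (x n))" "P S (x n) = 0"
        using blaschke_prod_large[of n T] blaschke_prod_zero[OF n] x by (simp_all add: P_def)
      moreover have "cmod (P T (x n)) \<le> cmod (P T (x n) - d T (x n)) + cmod (d T (x n))"
        using norm_triangle_sub[of "P T (x n)" "d T (x n)"] by simp
      ultimately show False
        using near_d[OF x, of T n] near_d[OF x, of S n] that by simp
    qed
  qed
  have "inj d" by (rule injI, rule subset_antisym) (auto intro: sub[THEN subsetD])
  moreover have "countable (range d)"
    using D(1) d(1) by (meson countable_subset image_subsetI)
  \<comment> \<open>The power set of the naturals embeds into the countable set \<open>D\<close>,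
    against Cantor.\<close>
  ultimately have "countable (UNIV :: nat set set)" by (meson countable_image_inj_on)
  then have "from_nat_into (UNIV :: nat set set) ` UNIV = Pow UNIV"
    by (simp add: range_from_nat_into)
  then show False using Cantors_theorem by blast
qed

end

theorem theorem5p12:
  fixes X :: "'a topology" and H :: "('a \<Rightarrow> complex) set"
    and ip :: "('a \<Rightarrow> complex) \<Rightarrow> ('a \<Rightarrow> complex) \<Rightarrow> complex"
    and w :: "'a \<Rightarrow> complex"
  assumes "connected_space X"
    and "hilbert_fun_space X H ip"
    and "one_independent X H"
    and "w \<in> Mult X H ip"
    and "\<exists>x\<in>topspace X. \<exists>y\<in>topspace X. w x \<noteq> w y"
    and "mult_norm H ip w = (SUP x\<in>topspace X. cmod (w x))"
  shows "\<not> mult_separable X H ip"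
proof -
  interpret hilbert_functions X H ip by standard (rule assms(2))
  note ind = assms(3) and w = assms(4)
  let ?N = "mult_norm H ip w"
  obtain y z where yz: "y \<in> topspace X" "z \<in> topspace X" "w y \<noteq> w z" using assms(5) by blast
  have le: "cmod (w x) \<le> ?N" if "x \<in> topspace X" for x
    using cmod_le_mult_norm[OF w ind that] .
  \<comment> \<open>Otherwise \<open>w\<close> would vanish at both \<open>y\<close> and
    \<open>z\<close>.\<close>
  have pos: "?N > 0"
  proof (rule ccontr)
    assume "\<not> ?N > 0"
    then have "cmod (w y) \<le> 0" "cmod (w z) \<le> 0"
      using le yz(1,2) by (meson not_less order_trans)+
    then show False using yz(3) by simp
  qed
  define v where "v x = w x / ?N" for x
  have cv: "cmod (v x) = cmod (w x) / ?N" for x using pos by (simp add: v_def norm_divide)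
  have v: "contractive v"
    unfolding contractive_def
  proof
    fix f assume f: "f \<in> H"
    have wf: "(\<lambda>x. w x * f x) \<in> H" using w f by (simp add: Mult_def)
    have eq: "(\<lambda>x. v x * f x) = (\<lambda>x. (1 / complex_of_real ?N) * (w x * f x))" by (simp add: v_def)
    have "cmod (1 / complex_of_real ?N) * hn (\<lambda>x. w x * f x) \<le> hn f"
      using hn_mult_le[OF w f] pos by (simp add: norm_divide divide_le_eq mult.commute)
    then show "(\<lambda>x. v x * f x) \<in> H \<and> hn (\<lambda>x. v x * f x) \<le> hn f"
      unfolding eq hn_scale[OF wf] using mem_scale[OF wf] by blast
  qed
  show ?thesis
  proof (rule not_separable[OF ind v])
    fix x assume x: "x \<in> topspace X"
    show "cmod (v x) < 1"
    proof (rule contractive_less_1[OF assms(1) ind v _ x yz(1,2)])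
      show "cmod (v x) \<le> 1" using le[OF x] pos by (simp add: cv)
      show "v y \<noteq> v z" using yz(3) pos by (simp add: v_def)
    qed
  next
    fix e :: real assume e: "e > 0"
    \<comment> \<open>Equality of the multiplier norm and the sup norm enters here: values of
      \<open>cmod v\<close> come arbitrarily close to 1.\<close>
    have "?N * (1 - e) < (SUP x\<in>topspace X. cmod (w x))"
      using pos e assms(6) by (simp add: algebra_simps)
    then obtain x where "x \<in> topspace X" "?N * (1 - e) < cmod (w x)"
      using yz(1) le by (subst (asm) less_cSUP_iff) (auto intro!: bdd_aboveI2)
    then show "\<exists>x\<in>topspace X. 1 - cmod (v x) < e"
      using pos by (intro bexI[of _ x]) (auto simp: cv field_simps)
  qed
qed

end
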